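(* Let $N$ be an absolute prime with $n>3$ decimal digits that is not a repunit. Then $11088\mid n$ (note $11088=\mathrm{lcm}(16,18,22,28)$).
   Context: For a positive integer $N$ with decimal representation $d_1d_2\dots d_n$ (digits $d_k\in\{0,\dots,9\}$, $d_1\neq 0$), a permutation of the digits of $N$ is any integer $\sum_{k=1}^{n} d_{\sigma(k)}10^{n-k}$ with $\sigma$ a permutation of $\{1,\dots,n\}$. $N$ is called an absolute prime if every integer obtained by a permutation of the digits of $N$ (including $N$ itself) is prime. A repunit is an integer $A_m=(10^m-1)/9$, all of whose decimal digits are $1$. *)

theory Defs
  imports "HOL-Computational_Algebra.Primes" "HOL-Library.Multiset"
begin

fun dec_digits :: "nat \<Rightarrow> nat list" where
  "dec_digits n = (if n = 0 then [] else dec_digits (n div 10) @ [n mod 10])"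

declare dec_digits.simps[simp del]

definition digits_value :: "nat list \<Rightarrow> nat" where
  "digits_value ds = foldl (\<lambda>a d. 10 * a + d) 0 ds"

definition absolute_prime :: "nat \<Rightarrow> bool" where
  "absolute_prime N \<longleftrightarrow> N > 0 \<and>
     (\<forall>ds. mset ds = mset (dec_digits N) \<longrightarrow> prime (digits_value ds))"

definition repunit :: "nat \<Rightarrow> nat" where
  "repunit m = (10 ^ m - 1) div 9"

end

theory Submission
  imports Defs "HOL-Number_Theory.Residue_Primitive_Roots" "HOL-Library.Code_Binary_Nat"
begin

text \<open>
  All digits are 1, 3, 7 or 9, since any other digit could be moved to the end. If a group of digits
  can be rearranged so as to reach every residue modulo 7, then some permutation of \<open>N\<close> is divisible
  by 7. The groups 1379 and \<open>aaabb\<close> have this property, so \<open>N\<close> has at most one digit \<open>b\<close> that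
  differs from a common digit \<open>a\<close>, up to the patterns \<open>a\<dots>abc\<close> (excluded modulo 7 and 13) and a few
  short ones. For the pattern with one exceptional digit the permutations are
  \<open>a R + (b - a) 10 ^ i\<close>, where \<open>R\<close> is the repunit of length \<open>n\<close>. If 10 is a primitive root modulo \<open>p\<close>
  and \<open>n \<ge> p - 1\<close>, then \<open>(b - a) 10 ^ i\<close> runs through all nonzero residues, so \<open>p\<close> has to divide \<open>R\<close>
  (provided \<open>p\<close> does not divide \<open>a\<close>), that is, \<open>p - 1\<close> divides \<open>n\<close>. This applies to
  \<open>p = 7, 17, 19, 23, 29\<close>; the lengths up to 16 that survive \<open>p = 7\<close> are settled by explicit divisors.
\<close>

section \<open>Values of digit lists and repunits\<close>

definition permutably_prime :: "nat multiset \<Rightarrow> bool" where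
  "permutably_prime M \<longleftrightarrow> (\<forall>ds. mset ds = M \<longrightarrow> prime (digits_value ds))"

lemma permutably_primeD: "permutably_prime M \<Longrightarrow> mset ds = M \<Longrightarrow> prime (digits_value ds)"
  by (simp add: permutably_prime_def)

lemma digits_value_Nil [simp]: "digits_value [] = 0"
  by (simp add: digits_value_def)

lemma digits_value_snoc [simp]: "digits_value (xs @ [d]) = 10 * digits_value xs + d"
  by (simp add: digits_value_def)

lemma digits_value_append:
  "digits_value (xs @ ys) = digits_value xs * 10 ^ length ys + digits_value ys"
proof (induction ys rule: rev_induct)
  case (snoc y ys)
  then show ?case
    using digits_value_snoc[of "xs @ ys" y] by (simp add: algebra_simps)
qed simp

lemma digits_value_Cons: "digits_value (d # xs) = d * 10 ^ length xs + digits_value xs"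
  using digits_value_append[of "[d]" xs] digits_value_snoc[of "[]" d] by simp

lemma digits_value_dec_digits: "digits_value (dec_digits n) = n"
  by (induction n rule: dec_digits.induct) (subst dec_digits.simps, simp)

lemma dec_digits_less_10: "d \<in> set (dec_digits n) \<Longrightarrow> d < 10"
proof (induction n rule: dec_digits.induct)
  case (1 n)
  then show ?case
    by (subst (asm) dec_digits.simps) (auto split: if_splits)
qed

text \<open>The division in \<open>repunit\<close> is exact because 10 is 1 modulo 9; the form with
  \<open>+ 1\<close> avoids truncated subtraction.\<close>

lemma nine_repunit: "9 * repunit m + 1 = 10 ^ m"
proof -
  have "[10 ^ m = 1 ^ m] (mod (9::nat))"
    by (intro cong_pow) (simp add: cong_def)
  then have "9 dvd 10 ^ m - (1::nat)"
    by (simp add: cong_altdef_nat)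
  then have "9 * repunit m = 10 ^ m - 1"
    by (simp add: repunit_def)
  then show ?thesis by simp
qed

lemma repunit_0 [simp]: "repunit 0 = 0"
  by (simp add: repunit_def)

lemma repunit_Suc: "repunit (Suc m) = 10 * repunit m + 1"
  using nine_repunit[of m] nine_repunit[of "Suc m"] by simp

lemma repunit_mono: "m \<le> n \<Longrightarrow> repunit m \<le> repunit n"
  by (simp add: repunit_def div_le_mono diff_le_mono power_increasing)

lemma repunit_le_digits_value:
  "(\<And>d. d \<in> set ds \<Longrightarrow> 0 < d) \<Longrightarrow> repunit (length ds) \<le> digits_value ds"
proof (induction ds rule: rev_induct)
  case (snoc d ds)
  then have "repunit (length ds) \<le> digits_value ds" "0 < d" by auto
  then show ?case by (simp add: repunit_Suc)
qed simp

lemma digits_value_replicate: "digits_value (replicate m a) = a * repunit m"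
proof (induction m)
  case (Suc m)
  have "digits_value (replicate (Suc m) a) = 10 * digits_value (replicate m a) + a"
    by (metis digits_value_snoc replicate_Suc replicate_append_same)
  with Suc show ?case by (simp add: repunit_Suc algebra_simps)
qed simp

text \<open>The subtraction of \<open>a * 10 ^ i\<close> is moved to the other side to stay within the natural numbers.\<close>

lemma digits_value_one_exception:
  assumes "i < n"
  shows "\<exists>ds. mset ds = add_mset b (replicate_mset (n - 1) a) \<and>
              digits_value ds + a * 10 ^ i = a * repunit n + b * 10 ^ i"
proof -
  let ?xs = "replicate (n - Suc i) a" and ?ys = "replicate i a"
  have "replicate n a = ?xs @ a # ?ys"
    using assms replicate_add[of "n - Suc i" "Suc i" a] by simp
  then have "a * repunit n = digits_value (?xs @ a # ?ys)"
    by (metis digits_value_replicate)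
  moreover have "mset (?xs @ b # ?ys) = add_mset b (replicate_mset (n - 1) a)"
    using assms by (auto simp: multiset_eq_iff)
  ultimately show ?thesis
    by (intro exI[of _ "?xs @ b # ?ys"])
       (simp add: digits_value_append digits_value_Cons algebra_simps)
qed

section \<open>Digits of a permutably prime multiset\<close>

text \<open>If a prime factor \<open>p\<close> of 10 divides \<open>d\<close>, putting
  \<open>d\<close> last gives a multiple of \<open>p\<close>. Being prime, this value is
  \<open>p\<close> itself.\<close>

lemma permutably_prime_digit_coprime:
  assumes M: "permutably_prime M" and "size M > 1" and "d \<in># M"
  shows "odd d" "\<not> 5 dvd d"
proof -
  obtain xs where xs: "M = mset (xs @ [d])"
    using \<open>d \<in># M\<close> by (metis ex_mset insert_DiffM2 mset_append mset_single_iff_right)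
  have *: "\<not> p dvd d" if p: "prime p" "p dvd 10" for p :: nat
  proof
    assume "p dvd d"
    with p have "p dvd digits_value (xs @ [d])" by (simp add: dvd_trans)
    moreover have "prime (digits_value (xs @ [d]))" using M xs by (blast intro: permutably_primeD)
    ultimately have eq: "digits_value (xs @ [d]) = p" using p by (metis primes_dvd_imp_eq)
    have "p \<le> 5"
    proof -
      have "p dvd 2 * 5" using p by simp
      then have "p dvd 2 \<or> p dvd 5" using p prime_dvd_mult_iff by blast
      then show ?thesis by (auto dest: dvd_imp_le)
    qed
    \<comment> \<open>A value of at most 5 leaves nothing for the other digits, so putting
      \<open>d\<close> first yields a multiple of 10.\<close>
    with eq have "digits_value xs = 0" by simp
    then have "digits_value (d # xs) = d * 10 ^ length xs" by (simp add: digits_value_Cons)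
    moreover have "length xs > 0" using \<open>size M > 1\<close> xs by simp
    ultimately have "10 dvd digits_value (d # xs)" by (simp add: dvd_power)
    moreover have "prime (digits_value (d # xs))" using M xs by (auto intro: permutably_primeD)
    ultimately have "prime (10::nat)"
      by (metis One_nat_def dvd_antisym numeral_eq_one_iff prime_nat_iff semiring_norm(85)
          one_less_numeral_iff)
    moreover have "\<not> prime (10::nat)" by simp
    ultimately show False by blast
  qed
  show "odd d" using *[of 2] by simp
  show "\<not> 5 dvd d" using *[of 5] by simp
qed

lemma digit_coprime_10:
  fixes d :: nat
  assumes "d < 10" "odd d" "\<not> 5 dvd d"
  shows "d \<in> {1, 3, 7, 9}"
proof -
  have "d \<in> {0,1,2,3,4,5,6,7,8,9}" using assms(1) by auto
  with assms show ?thesis by auto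
qed

text \<open>Four nonzero digits give a value of at least 1111, so such a \<open>d\<close> would be a
  proper divisor. The bound 1000 is a round number above every divisor used below.\<close>

lemma permutably_prime_not_dvd:
  assumes M: "permutably_prime M" "size M > 3" "set_mset M \<subseteq> {1, 3, 7, 9}"
    and ds: "mset ds = M" and d: "1 < d" "d < 1000"
  shows "\<not> d dvd digits_value ds"
proof
  assume dvd: "d dvd digits_value ds"
  have "set ds \<subseteq> {1, 3, 7, 9}" using M(3) ds by auto
  then have "\<And>x. x \<in> set ds \<Longrightarrow> 0 < x" by auto
  then have "repunit (length ds) \<le> digits_value ds" by (rule repunit_le_digits_value)
  moreover have "repunit 4 \<le> repunit (length ds)"
    using M(2) ds by (intro repunit_mono) auto
  moreover have "repunit 4 = 1111" by (simp add: repunit_def)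
  ultimately have "d < digits_value ds" using d by simp
  moreover have "prime (digits_value ds)" using M(1) ds by (rule permutably_primeD)
  ultimately show False using dvd d by (auto simp: prime_nat_iff)
qed

text \<open>The digits outside the block are put in front in a fixed order. Their value
  \<open>c\<close> is then the same for all arrangements of the block, so a block reaching every
  residue gives a contradiction.\<close>

lemma permutably_prime_not_dvd_block:
  assumes M: "permutably_prime M" "size M > 3" "set_mset M \<subseteq> {1, 3, 7, 9}"
    and "mset ys \<subseteq># M"
  obtains c where "\<And>zs d. mset zs = mset ys \<Longrightarrow> 1 < d \<Longrightarrow> d < 1000 \<Longrightarrow>
    \<not> d dvd c * 10 ^ length zs + digits_value zs"
proof -
  obtain xs where "M = mset xs + mset ys"
    using assms(4) by (metis ex_mset subset_mset.diff_add)
  then have "\<not> d dvd digits_value xs * 10 ^ length zs + digits_value zs"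
    if "mset zs = mset ys" "1 < d" "d < 1000" for zs d
    using permutably_prime_not_dvd[OF M, of "xs @ zs" d] that by (simp add: digits_value_append)
  then show ?thesis using that by blast
qed

section \<open>Rearrangements divisible by a small prime\<close>

text \<open>Only \<open>c mod m\<close> matters, which reduces an arbitrary prefix to a finite
  check.\<close>

lemma dvd_block_if_residues_covered:
  fixes c m :: nat
  assumes "m > 0" "\<forall>zs\<in>set L. mset zs = K \<and> length zs = k"
    and "\<And>r. r < m \<Longrightarrow> \<exists>zs\<in>set L. m dvd r * 10 ^ k + digits_value zs"
  shows "\<exists>zs. mset zs = K \<and> m dvd c * 10 ^ length zs + digits_value zs"
proof -
  obtain zs where zs: "zs \<in> set L" "m dvd (c mod m) * 10 ^ k + digits_value zs"
    using assms(1,3) by (meson mod_less_divisor)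
  have "m dvd c * 10 ^ k + digits_value zs"
    using zs(2) unfolding dvd_eq_mod_eq_0 by (metis mod_add_left_eq mod_mult_left_eq)
  with zs(1) assms(2) show ?thesis by auto
qed

lemma cover_1379:
  fixes c :: nat
  shows "\<exists>zs. mset zs = {#1, 3, 7, 9#} \<and> 7 dvd c * 10 ^ length zs + digits_value zs"
proof (rule dvd_block_if_residues_covered[where k = 4])
  \<comment> \<open>These values leave the remainders 0, 1, 2, 3, 4, 5, 6 modulo 7, in this
    order.\<close>
  let ?L = "[[1,3,7,9],[1,7,9,3],[3,7,1,9],[1,7,3,9],[1,3,9,7],[1,9,3,7],[7,1,3,9]]"
  show "\<forall>zs\<in>set ?L. mset zs = {#1, 3, 7, 9#} \<and> length zs = 4" by simp
  have "\<forall>r\<in>set [0..<7]. \<exists>zs\<in>set ?L. 7 dvd r * 10 ^ 4 + digits_value zs" by code_simp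
  then show "\<exists>zs\<in>set ?L. 7 dvd r * 10 ^ 4 + digits_value zs" if "r < 7" for r
    using that by simp
qed simp

text \<open>All ten arrangements are listed. Each differs from \<open>aaaaa\<close> by
  \<open>(b - a) * (10 ^ i + 10 ^ j)\<close> with \<open>i\<close> and \<open>j\<close> distinct and
  below 5. Modulo 7 these powers are 1, 3, 2, 6, 4, their pairwise sums cover all residues, and
  \<open>b - a\<close> is invertible.\<close>

lemma residues_aaabb:
  "\<forall>a\<in>{1, 3, 7, 9}. \<forall>b\<in>{1, 3, 7, 9}. a \<noteq> b \<longrightarrow> (\<forall>r\<in>set [0..<7].
    \<exists>zs\<in>set [[b,b,a,a,a], [b,a,b,a,a], [b,a,a,b,a], [b,a,a,a,b], [a,b,b,a,a],
             [a,b,a,b,a], [a,b,a,a,b], [a,a,b,b,a], [a,a,b,a,b], [a,a,a,b,b]].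
      7 dvd r * 10 ^ 5 + digits_value zs)"
  by code_simp

lemma cover_aaabb:
  fixes a b c :: nat
  assumes "a \<in> {1, 3, 7, 9}" "b \<in> {1, 3, 7, 9}" "a \<noteq> b"
  shows "\<exists>zs. mset zs = {#a, a, a, b, b#} \<and> 7 dvd c * 10 ^ length zs + digits_value zs"
proof (rule dvd_block_if_residues_covered[where k = 5])
  let ?L = "[[b,b,a,a,a], [b,a,b,a,a], [b,a,a,b,a], [b,a,a,a,b], [a,b,b,a,a],
             [a,b,a,b,a], [a,b,a,a,b], [a,a,b,b,a], [a,a,b,a,b], [a,a,a,b,b]]"
  show "\<forall>zs\<in>set ?L. mset zs = {#a, a, a, b, b#} \<and> length zs = 5" by simp
  show "\<exists>zs\<in>set ?L. 7 dvd r * 10 ^ 5 + digits_value zs" if "r < 7" for r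
  proof -
    have "r \<in> set [0..<7]" using that by simp
    then show ?thesis by (rule residues_aaabb[rule_format, OF assms])
  qed
qed simp

text \<open>Since \<open>91 = 7 * 13\<close>, this controls the repunits modulo both primes at once.\<close>

lemma repunit_mod_91: "repunit m mod 91 \<in> {0, 1, 9, 11, 19, 20}"
proof (induction m)
  case (Suc m)
  have "repunit (Suc m) mod 91 = (10 * (repunit m mod 91) + 1) mod 91"
    unfolding repunit_Suc by (metis mod_add_left_eq mod_mult_right_eq)
  with Suc show ?case by auto
qed simp

text \<open>All digits in front of the block equal \<open>a\<close>, so only the six residues from
  \<open>repunit_mod_91\<close> occur in the prefix. Which of 7 and 13 divides may depend on the
  case.\<close>

lemma residues_aaaabc:
  "\<forall>a\<in>{1, 3, 7, 9}. \<forall>b\<in>{1, 3, 7, 9}. \<forall>c\<in>{1, 3, 7, 9}. distinct [a, b, c] \<longrightarrow>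
    (\<forall>r\<in>{0, 1, 9, 11, 19, 20}.
      \<exists>zs\<in>set [[a,a,b,a,c,a], [a,a,c,a,b,a], [a,a,a,a,b,c], [a,a,a,a,c,b],
             [a,a,a,c,a,b], [c,a,a,b,a,a], [a,a,a,b,a,c], [b,a,a,c,a,a]].
      \<exists>d\<in>{7, 13}. d dvd a * r * 10 ^ 6 + digits_value zs)"
  by code_simp

lemma cover_aaaabc:
  fixes a b c m :: nat
  assumes "a \<in> {1, 3, 7, 9}" "b \<in> {1, 3, 7, 9}" "c \<in> {1, 3, 7, 9}" "distinct [a, b, c]"
  shows "\<exists>zs. mset zs = {#a, a, a, a, b, c#} \<and>
    (\<exists>d\<in>{7, 13}. d dvd a * repunit m * 10 ^ length zs + digits_value zs)"
proof -
  let ?L = "[[a,a,b,a,c,a], [a,a,c,a,b,a], [a,a,a,a,b,c], [a,a,a,a,c,b],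
             [a,a,a,c,a,b], [c,a,a,b,a,a], [a,a,a,b,a,c], [b,a,a,c,a,a]]"
  from residues_aaaabc[rule_format, OF assms repunit_mod_91[of m]] obtain zs d
    where zs: "zs \<in> set ?L" and d: "d \<in> {7, 13}"
      and dvd: "d dvd a * (repunit m mod 91) * 10 ^ 6 + digits_value zs"
    by blast
  have "d dvd 91" using d by auto
  then have "[repunit m mod 91 = repunit m] (mod d)"
    by (simp add: cong_def mod_mod_cancel)
  then have "[a * (repunit m mod 91) * 10 ^ 6 + digits_value zs
            = a * repunit m * 10 ^ 6 + digits_value zs] (mod d)"
    by (intro cong_add cong_mult cong_refl)
  then have "d dvd a * repunit m * 10 ^ 6 + digits_value zs"
    using dvd by (simp only: cong_dvd_iff)
  moreover have "mset zs = {#a, a, a, a, b, c#}" "length zs = 6" using zs by auto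
  ultimately show ?thesis using d by metis
qed

text \<open>In this and the next two lemmas the block is the whole number, so there is no prefix to
  vary over. The divisor 3 depends on the digit sum alone.\<close>

lemma dvd_aabc:
  "\<forall>a\<in>{1, 3, 7, 9}. \<forall>b\<in>{1, 3, 7, 9}. \<forall>c\<in>{1, 3, 7, 9}. distinct [a, b, c] \<longrightarrow>
    (\<exists>zs\<in>set [[a,b,c,a], [b,a,c,a], [b,c,a,a], [a,a,b,c], [b,a,a,c], [c,a,b,a]].
      (\<exists>d\<in>{3, 7, 13}. d dvd digits_value zs) \<and> mset zs = {#a, a, b, c#})"
  by code_simp

lemma dvd_aaabc:
  "\<forall>a\<in>{1, 3, 7, 9}. \<forall>b\<in>{1, 3, 7, 9}. \<forall>c\<in>{1, 3, 7, 9}. distinct [a, b, c] \<longrightarrow>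
    (\<exists>zs\<in>set [[a,c,a,a,b], [a,a,b,a,c], [a,b,c,a,a], [a,a,c,a,b], [a,c,b,a,a], [a,b,a,a,c]].
      (\<exists>d\<in>{3, 7}. d dvd digits_value zs) \<and> mset zs = {#a, a, a, b, c#})"
  by code_simp

lemma dvd_aabbc:
  "\<forall>a\<in>{1, 3, 7, 9}. \<forall>b\<in>{1, 3, 7, 9}. \<forall>c\<in>{1, 3, 7, 9}. distinct [a, b, c] \<longrightarrow>
    (\<exists>zs\<in>set [[b,a,b,c,a], [c,b,b,a,a], [a,b,b,c,a], [b,a,a,c,b], [a,b,c,b,a], [c,a,a,b,b]].
      (\<exists>d\<in>{3, 7}. d dvd digits_value zs) \<and> mset zs = {#a, a, b, b, c#})"
  by code_simp

section \<open>All digits but at most one are equal\<close>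

text \<open>Let \<open>a\<close> have the greatest multiplicity \<open>w\<close>. Some digit
  \<open>d\<close> is missing because of the block 1379, so the multiplicities of \<open>a\<close>,
  \<open>b\<close>, \<open>c\<close> are \<open>w >= x >= y\<close>. The block \<open>aaabb\<close>
  forces \<open>x <= 1\<close> once \<open>w >= 3\<close>. Outside the conclusion this leaves six
  patterns, each refuted by a divisor.\<close>

lemma permutably_prime_shape:
  assumes M: "permutably_prime M" "size M > 3" "set_mset M \<subseteq> {1, 3, 7, 9}"
  shows "\<exists>a b. a \<in> {1, 3, 7, 9} \<and> b \<in> {1, 3, 7, 9} \<and> a \<noteq> b \<and>
    (M = replicate_mset (size M) a \<or> M = add_mset b (replicate_mset (size M - 1) a))"
proof -
  let ?D = "{1, 3, 7, 9} :: nat set"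
  note not_dvd = permutably_prime_not_dvd[OF M]
  have "Max (count M ` ?D) \<in> count M ` ?D" by (rule Max_in) auto
  then obtain a where a: "Max (count M ` ?D) = count M a" "a \<in> ?D" by (rule imageE)
  have max: "count M z \<le> count M a" if "z \<in> ?D" for z
    unfolding a(1)[symmetric] using that by (intro Max_ge finite_imageI imageI) simp
  have "\<not> ?D \<subseteq> set_mset M"
  proof
    assume "?D \<subseteq> set_mset M"
    then have "mset [1, 3, 7, 9] \<subseteq># M"
      by (intro mset_subset_eqI) (auto simp: Suc_le_eq)
    then obtain e where "\<And>zs d. mset zs = mset [1, 3, 7, 9] \<Longrightarrow> 1 < d \<Longrightarrow> d < 1000 \<Longrightarrow>
        \<not> d dvd e * 10 ^ length zs + digits_value zs"
      using permutably_prime_not_dvd_block[OF M] by blast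
    with cover_1379[of e] show False by force
  qed
  then obtain d where d: "d \<in> ?D" "count M d = 0" by (auto simp: not_in_iff)
  have "M \<noteq> {#}" using M(2) by auto
  then obtain z where "z \<in># M" by blast
  then have "count M a > 0"
    using max[of z] M(3) by (metis count_greater_zero_iff le_zero_eq neq0_conv subsetD)
  then have "a \<noteq> d" using d(2) by (metis less_irrefl)
  then have "card (?D - {a, d}) = 2" using a(2) d(1) by (simp add: card_Diff_subset)
  then obtain b c where bc: "?D - {a, d} = {b, c}" "b \<noteq> c" "count M c \<le> count M b"
  proof -
    obtain b c where "?D - {a, d} = {b, c}" "b \<noteq> c"
      using \<open>card (?D - {a, d}) = 2\<close> unfolding card_2_iff by blast
    then show thesis
      using that[of b c] that[of c b] by (cases "count M c \<le> count M b") (auto simp: insert_commute)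
  qed
  then have mem: "b \<in> ?D" "c \<in> ?D" and dist: "a \<noteq> b" "a \<noteq> c" by blast+
  define w x y where "w = count M a" "x = count M b" "y = count M c"
  have Meq: "M = replicate_mset w a + replicate_mset x b + replicate_mset y c"
  proof (rule multiset_eqI)
    fix z
    have "count M z = 0" if "z \<notin> {a, b, c}"
    proof (cases "z = d")
      case False
      with that bc(1) have "z \<notin> ?D" by blast
      with M(3) show ?thesis by (meson not_in_iff subsetD)
    qed (use d in simp)
    then show "count M z = count (replicate_mset w a + replicate_mset x b + replicate_mset y c) z"
      using dist bc(2) by (auto simp: w_x_y_def)
  qed
  have le: "x \<le> w" "y \<le> x"
    using max[OF mem(1)] bc(3) by (simp_all add: w_x_y_def)
  have size: "size M = w + x + y"
    using arg_cong[OF Meq, of size] by simp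
  have x1: "x \<le> 1" if "w \<ge> 3"
  proof (rule ccontr)
    assume "\<not> x \<le> 1"
    with that have "mset [a, a, a, b, b] \<subseteq># M"
      using dist(1) by (intro mset_subset_eqI) (auto simp: w_x_y_def)
    then obtain e where "\<And>zs d. mset zs = mset [a, a, a, b, b] \<Longrightarrow> 1 < d \<Longrightarrow> d < 1000 \<Longrightarrow>
        \<not> d dvd e * 10 ^ length zs + digits_value zs"
      using permutably_prime_not_dvd_block[OF M] by blast
    with cover_aaabb[OF a(2) mem(1) dist(1), of e] show False by force
  qed
  have dist3: "distinct [a, b, c]" using dist bc(2) by simp
  note mem3 = a(2) mem dist3
  have False if "w = 2" "x = 1" "y = 1"
  proof -
    have "M = {#a, a, b, c#}" using Meq that by (simp add: numeral_2_eq_2)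
    with dvd_aabc[rule_format, OF mem3]
    obtain zs d where "mset zs = M" "d \<in> {3, 7, 13}" "d dvd digits_value zs" by blast
    then show False using not_dvd[of zs d] by auto
  qed
  moreover have False if "w = 2" "x = 2" "y = 0"
  proof -
    have "mset [a, b, a, b] = M" using Meq that by (simp add: numeral_2_eq_2)
    moreover have "digits_value [a, b, a, b] = 101 * (10 * a + b)" by (simp add: digits_value_def)
    ultimately show False using not_dvd[of "[a, b, a, b]" 101] by simp
  qed
  moreover have False if "w = 2" "x = 2" "y = 1"
  proof -
    have "M = {#a, a, b, b, c#}" using Meq that by (simp add: numeral_2_eq_2)
    with dvd_aabbc[rule_format, OF mem3]
    obtain zs d where "mset zs = M" "d \<in> {3, 7}" "d dvd digits_value zs" by blast
    then show False using not_dvd[of zs d] by auto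
  qed
  moreover have False if "w = 2" "x = 2" "y = 2"
  proof -
    have "mset [a, b, c, a, b, c] = M" using Meq that by (simp add: numeral_2_eq_2)
    moreover have "digits_value [a, b, c, a, b, c] = 7 * (143 * (100 * a + 10 * b + c))"
      by (simp add: digits_value_def)
    ultimately show False using not_dvd[of "[a, b, c, a, b, c]" 7] by simp
  qed
  moreover have False if "w = 3" "x = 1" "y = 1"
  proof -
    have "M = {#a, a, a, b, c#}" using Meq that by (simp add: numeral_3_eq_3)
    with dvd_aaabc[rule_format, OF mem3]
    obtain zs d where "mset zs = M" "d \<in> {3, 7}" "d dvd digits_value zs" by blast
    then show False using not_dvd[of zs d] by auto
  qed
  moreover have False if "w \<ge> 4" "x = 1" "y = 1"
  proof -
    obtain m where m: "w = m + 4" using \<open>w \<ge> 4\<close> by (metis add.commute le_Suc_ex)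
    obtain zs d where zs: "mset zs = {#a, a, a, a, b, c#}" "d \<in> {7, 13}"
      "d dvd a * repunit m * 10 ^ length zs + digits_value zs"
      using cover_aaaabc[OF mem3, of m] by blast
    have "mset (replicate m a @ zs) = M" using Meq that zs(1) m by (simp add: numeral_eq_Suc)
    moreover have "d dvd digits_value (replicate m a @ zs)"
      using zs(3) by (simp add: digits_value_append digits_value_replicate)
    ultimately show False using not_dvd[of "replicate m a @ zs" d] zs(2) by auto
  qed
  \<comment> \<open>With \<open>w <= 1\<close> there would be at most three digits.\<close>
  moreover have "w = 2 \<or> w = 3 \<or> w \<ge> 4" using le size M(2) by linarith
  ultimately have "x \<le> 1 \<and> y = 0"
    using le x1 size M(2) by presburger
  then have "M = replicate_mset (size M) a \<or> M = add_mset b (replicate_mset (size M - 1) a)"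
    using Meq size by (cases x) auto
  with a(2) mem(1) dist(1) show ?thesis by blast
qed

section \<open>A single exceptional digit\<close>

text \<open>The order of \<open>g\<close> is at most \<open>p - 1\<close>, and the smaller exponents
  are excluded by a condition that can be evaluated.\<close>

lemma residue_primroot_primeI:
  assumes "prime p" "coprime p g" "\<forall>k\<in>set [1..<p - 1]. g ^ k mod p \<noteq> 1"
  shows "residue_primroot p (g::nat)"
proof -
  have "ord p g dvd p - 1"
    using order_divides_totient[of p g] assms by (simp add: totient_prime)
  then have le: "ord p g \<le> p - 1"
    using prime_gt_1_nat[OF assms(1)] by (intro dvd_imp_le) auto
  have "g ^ ord p g mod p = 1"
    using ord[of g p] prime_gt_1_nat[OF assms(1)] by (simp add: cong_def)
  moreover have "ord p g > 0" using assms(2) by simp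
  ultimately have "ord p g = p - 1" using assms(3) le
    by (metis One_nat_def Suc_leI atLeastLessThan_iff le_neq_implies_less set_upt)
  then show ?thesis
    using assms by (simp add: residue_primroot_def totient_prime prime_gt_0_nat)
qed

lemma residue_primroot_10:
  "residue_primroot 7 10" "residue_primroot 17 10" "residue_primroot 19 10"
  "residue_primroot 23 10" "residue_primroot 29 10"
  by (rule residue_primroot_primeI, simp, code_simp, code_simp)+

text \<open>The equation \<open>(b - a) * t = - a * repunit n\<close> is solvable modulo
  \<open>p\<close>. Since \<open>9 * repunit n + 1 = 10 ^ n\<close> and 10 has order
  \<open>p - 1\<close>, the right side is nonzero; hence so is \<open>t\<close>, which is therefore
  a power of 10.\<close>

lemma exception_dvd_if_primroot:
  fixes p a b n :: nat
  assumes p: "prime p" "residue_primroot p 10"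
    and ab: "\<not> p dvd a" "\<not> [a = b] (mod p)" and n: "\<not> (p - 1) dvd n"
  shows "\<exists>i<p - 1. [a * repunit n + b * 10 ^ i = a * 10 ^ i] (mod p)"
proof -
  have p1: "p > 1" using p(1) by (rule prime_gt_1_nat)
  have ordp: "ord p 10 = p - 1" using p by (simp add: residue_primroot_def totient_prime)
  have "\<not> p dvd repunit n"
  proof
    assume "p dvd repunit n"
    then have "[9 * repunit n + 1 = 1] (mod p)"
      by (metis add_0 cong_0_iff cong_add_rcancel_nat dvd_mult)
    then have "[10 ^ n = 1] (mod p)" by (simp only: nine_repunit)
    then show False using n ordp by (metis ord_divides)
  qed
  with ab(1) p(1) have aR: "\<not> p dvd a * repunit n" by (simp add: prime_dvd_mult_iff)
  \<comment> \<open>The integers are used because \<open>b\<close> may be smaller than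
    \<open>a\<close>.\<close>
  have "\<not> int p dvd int b - int a"
    using ab(2) by (metis cong_iff_dvd_diff cong_int_iff cong_sym)
  then have "coprime (int b - int a) (int p)"
    using p(1) by (simp add: coprime_commute prime_imp_coprime)
  then obtain x where x: "[(int b - int a) * x = 1] (mod int p)"
    using cong_solve_coprime_int by blast
  define t where "t = nat ((- int (a * repunit n) * x) mod int p)"
  have t: "int t = (- int (a * repunit n) * x) mod int p" "t < p"
    using p1 by (auto simp: t_def nat_less_iff)
  have bt: "[(int b - int a) * int t = - int (a * repunit n)] (mod int p)"
  proof -
    have "[(int b - int a) * int t = (int b - int a) * (- int (a * repunit n) * x)] (mod int p)"
      by (intro cong_mult cong_refl) (simp add: t(1) cong_def)
    also have "(int b - int a) * (- int (a * repunit n) * x)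
        = - int (a * repunit n) * ((int b - int a) * x)" by (simp add: algebra_simps)
    also have "[\<dots> = - int (a * repunit n) * 1] (mod int p)"
      by (intro cong_mult cong_refl x)
    finally show ?thesis by simp
  qed
  have "t \<noteq> 0"
  proof
    assume "t = 0"
    with bt have "int p dvd - int (a * repunit n)" using cong_sym by (fastforce simp: cong_0_iff)
    with aR show False by (metis dvd_minus_iff of_nat_dvd_iff)
  qed
  with t(2) p(1) have "t \<in> totatives p" by (simp add: totatives_prime)
  then have "t \<in> (\<lambda>i. 10 ^ i mod p) ` {..<p - 1}"
    using residue_primroot_is_generator[OF p1 p(2)] p(1) by (simp add: bij_betw_def totient_prime)
  then obtain i where i: "i < p - 1" "10 ^ i mod p = t" by blast
  have "[int (10 ^ i) = int t] (mod int p)" using i(2) by (metis cong_int_iff cong_mod_left cong_refl)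
  then have "[(int b - int a) * int (10 ^ i) = - int (a * repunit n)] (mod int p)"
    using bt by (meson cong_mult cong_refl cong_trans)
  then have "int p dvd (int b - int a) * int (10 ^ i) - (- int (a * repunit n))"
    by (simp only: cong_iff_dvd_diff)
  then have "int p dvd int (a * repunit n + b * 10 ^ i) - int (a * 10 ^ i)"
    by (simp add: algebra_simps)
  then have "[int (a * repunit n + b * 10 ^ i) = int (a * 10 ^ i)] (mod int p)"
    by (simp only: cong_iff_dvd_diff)
  with i(1) show ?thesis by (metis cong_int_iff)
qed

text \<open>Cancelling \<open>a * 10 ^ i\<close> turns the congruence into divisibility of the
  arrangement with \<open>b\<close> at the place of weight \<open>10 ^ i\<close>.\<close>

lemma no_exception_dvd:
  assumes M: "permutably_prime M" "size M > 3" "set_mset M \<subseteq> {1, 3, 7, 9}"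
    and Meq: "M = add_mset b (replicate_mset (size M - 1) a)"
    and d: "1 < d" "d < 1000" and i: "i < size M"
  shows "\<not> [a * repunit (size M) + b * 10 ^ i = a * 10 ^ i] (mod d)"
proof
  assume cong: "[a * repunit (size M) + b * 10 ^ i = a * 10 ^ i] (mod d)"
  obtain ds where ds: "mset ds = M"
    "digits_value ds + a * 10 ^ i = a * repunit (size M) + b * 10 ^ i"
    using digits_value_one_exception[OF i, of b a] Meq by metis
  have "[digits_value ds + a * 10 ^ i = a * 10 ^ i] (mod d)" using cong ds(2) by simp
  then have "d dvd digits_value ds" by (simp add: cong_add_rcancel_0_nat cong_0_iff)
  with permutably_prime_not_dvd[OF M ds(1) d] show False by blast
qed

lemma pred_primroot_dvd_size:
  assumes M: "permutably_prime M" "size M > 3" "set_mset M \<subseteq> {1, 3, 7, 9}"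
    and Meq: "M = add_mset b (replicate_mset (size M - 1) a)"
    and ab: "a \<in> {1, 3, 7, 9}" "b \<in> {1, 3, 7, 9}" "a \<noteq> b"
    and p: "p \<in> {7, 17, 19, 23, 29}" "\<not> p dvd a" "p - 1 \<le> size M"
  shows "p - 1 dvd size M"
proof (rule ccontr)
  assume "\<not> p - 1 dvd size M"
  moreover have "prime p" "residue_primroot p 10" "1 < p" "p < 1000"
    using p(1) residue_primroot_10 by auto
  \<comment> \<open>Two distinct digits here differ by 2, 4, 6 or 8, never by a multiple of
    \<open>p\<close>.\<close>
  moreover have "\<not> [a = b] (mod p)"
    using p(1) ab by (elim insertE emptyE; simp add: cong_def)
  ultimately obtain i where "i < p - 1" "[a * repunit (size M) + b * 10 ^ i = a * 10 ^ i] (mod p)"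
    using exception_dvd_if_primroot p(2) by blast
  then show False
    using no_exception_dvd[OF M Meq, of p i] \<open>1 < p\<close> \<open>p < 1000\<close> p(3) by simp
qed

text \<open>The side condition describes what the prime 7 leaves open: its criterion needs length at
  least 6 and \<open>a\<close> different from 7.\<close>

lemma small_exception_dvd:
  "\<forall>n\<in>set [4..<17]. \<forall>a\<in>{1, 3, 7, 9}. \<forall>b\<in>{1, 3, 7, 9}.
    a \<noteq> b \<and> (n < 6 \<or> a = 7 \<or> 6 dvd n) \<longrightarrow>
    (\<exists>d\<in>{3, 7, 11, 13, 17, 19, 23, 29, 31, 43, 47, 151}. \<exists>i\<in>set [0..<n].
      [a * repunit n + b * 10 ^ i = a * 10 ^ i] (mod d))"
  unfolding cong_def by code_simp

lemma permutably_prime_exception_size: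
  assumes M: "permutably_prime M" "size M > 3" "set_mset M \<subseteq> {1, 3, 7, 9}"
    and Meq: "M = add_mset b (replicate_mset (size M - 1) a)"
    and ab: "a \<in> {1, 3, 7, 9}" "b \<in> {1, 3, 7, 9}" "a \<noteq> b"
  shows "11088 dvd size M"
proof -
  note dvd = pred_primroot_dvd_size[OF M Meq ab]
  have "size M > 16"
  proof (rule ccontr)
    assume "\<not> size M > 16"
    moreover have "size M < 6 \<or> a = 7 \<or> 6 dvd size M"
      using dvd[of 7] ab(1) by auto
    moreover have "size M \<in> set [4..<17]"
      unfolding set_upt atLeastLessThan_iff using calculation(1) M(2) by linarith
    ultimately obtain i d where "d \<in> {3, 7, 11, 13, 17, 19, 23, 29, 31, 43, 47, 151}"
      "i < size M" "[a * repunit (size M) + b * 10 ^ i = a * 10 ^ i] (mod d)"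
      using small_exception_dvd[rule_format, OF _ ab(1,2)] ab(3)
      by (metis atLeastLessThan_iff set_upt)
    moreover from this(1) have "1 < d" "d < 1000" by auto
    ultimately show False using no_exception_dvd[OF M Meq, of d i] by blast
  qed
  moreover have "16 dvd size M" using dvd[of 17] ab(1) calculation by auto
  \<comment> \<open>A multiple of 16 above 16 is at least 32, long enough for the primes 19, 23 and
    29.\<close>
  ultimately have "size M \<ge> 28" by (auto elim!: dvdE)
  then have "18 dvd size M" "22 dvd size M" "28 dvd size M"
    using dvd[of 19] dvd[of 23] dvd[of 29] ab(1) by auto
  with \<open>16 dvd size M\<close> have "lcm 16 (lcm 18 (lcm 22 28)) dvd size M"
    by (intro lcm_least)
  moreover have "lcm 16 (lcm 18 (lcm 22 28)) = (11088::nat)" by code_simp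
  ultimately show ?thesis by simp
qed

theorem theorem2:
  fixes N :: nat
  assumes "absolute_prime N"
    and "length (dec_digits N) > 3"
    and "\<forall>m. N \<noteq> repunit m"
  shows "11088 dvd length (dec_digits N)"
proof -
  define M where "M = mset (dec_digits N)"
  have size: "size M = length (dec_digits N)" by (simp add: M_def)
  have M: "permutably_prime M" "size M > 3"
    using assms(1,2) by (auto simp: M_def permutably_prime_def absolute_prime_def)
  have "d \<in> {1, 3, 7, 9}" if "d \<in># M" for d
    using permutably_prime_digit_coprime[OF M(1) _ that] M(2) dec_digits_less_10[of d N] that
    by (intro digit_coprime_10) (auto simp: M_def)
  then have D: "set_mset M \<subseteq> {1, 3, 7, 9}" by blast
  obtain a b where ab: "a \<in> {1, 3, 7, 9}" "b \<in> {1, 3, 7, 9}" "a \<noteq> b"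
    and shape: "M = replicate_mset (size M) a \<or> M = add_mset b (replicate_mset (size M - 1) a)"
    using permutably_prime_shape[OF M D] by blast
  \<comment> \<open>With all digits equal, \<open>a\<close> divides \<open>N\<close>; this leaves
    only \<open>a = 1\<close>, a repunit.\<close>
  have "M \<noteq> replicate_mset (size M) a"
  proof
    assume rep: "M = replicate_mset (size M) a"
    then have "set (dec_digits N) \<subseteq> {a}"
      by (metis M_def set_mset_mset set_mset_replicate_mset_subset empty_subsetI order_refl)
    then have "dec_digits N = replicate (size M) a"
      by (metis replicate_eqI singletonD size subsetD)
    then have N: "N = a * repunit (size M)"
      by (metis digits_value_dec_digits digits_value_replicate)
    show False
    proof (cases "a = 1")
      case True
      with N assms(3) show ?thesis by simp
    next
      case False
      with ab(1) have "1 < a" "a < 1000" by auto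
      moreover have "a dvd digits_value (dec_digits N)" using N by (simp add: digits_value_dec_digits)
      ultimately show ?thesis
        using permutably_prime_not_dvd[OF M D, of "dec_digits N" a] by (simp add: M_def)
    qed
  qed
  with shape have "M = add_mset b (replicate_mset (size M - 1) a)" by blast
  with permutably_prime_exception_size[OF M D _ ab] size show ?thesis by simp
qed

end
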